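(* Let $\mathcal F$ be an admissible sequence of polynomials, and let $\boldsymbol{x}=(x_1,\dots,x_n)$. For a sequence $\alpha=(\alpha_1,\dots,\alpha_r)$ of nonnegative integers, let $S^{\mathcal F}_\alpha(\boldsymbol{x})=\big(P^{\mathcal F}_{(\alpha_i,\alpha_j)}(\boldsymbol{x})\big)_{1\le i,j\le r}$ (an $r\times r$ skew-symmetric matrix). Then for every strict partition $\lambda=(\lambda_1,\dots,\lambda_l)$ of length $l$, $$P^{\mathcal F}_\lambda(\boldsymbol{x})=\begin{cases}\mathrm{Pf}\,S^{\mathcal F}_\lambda(\boldsymbol{x})&\text{if $l$ is even,}\\ \mathrm{Pf}\,S^{\mathcal F}_{\lambda^0}(\boldsymbol{x})&\text{if $l$ is odd,}\end{cases}$$ where $\lambda^0=(\lambda_1,\dots,\lambda_l,0)$.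
   Context: $K$ is a field of characteristic $0$. A sequence $\mathcal F=\{f_d\}_{d=0}^\infty$ of polynomials $f_d(u)\in K[u]$ is admissible if $f_0=1$ and $\deg f_d=d$ for all $d\ge 1$. A strict partition of length $l$ is a strictly decreasing sequence $\lambda=(\lambda_1>\dots>\lambda_l)$ of positive integers (the empty sequence $\emptyset$ has length $0$). ${}^tM$ denotes the transpose of $M$, $O$ a zero matrix, and $\mathrm{Pf}$ the Pfaffian (the empty Pfaffian is $1$). For indeterminates $\boldsymbol{x}=(x_1,\dots,x_n)$ put $A(\boldsymbol{x})=\left(\frac{x_j-x_i}{x_j+x_i}\right)_{1\le i,j\le n}$ and $\Delta(\boldsymbol{x})=\prod_{1\le i<j\le n}\frac{x_j-x_i}{x_j+x_i}$. For a sequence $\alpha=(\alpha_1,\dots,\alpha_r)$ of nonnegative integers let $V^{\mathcal F}_\alpha(\boldsymbol{x})=(f_{\alpha_j}(x_i))_{1\le i\le n,\,1\le j\le r}$. For a strict partition $\lambda$ of length $l$ (any $l\ge 0$), the generalized $P$-function is $$P^{\mathcal F}_\lambda(\boldsymbol{x})=\frac{1}{\Delta(\boldsymbol{x})}\mathrm{Pf}\begin{pmatrix}A(\boldsymbol{x})&V^{\mathcal F}_{\lambda^*}(\boldsymbol{x})\\-{}^tV^{\mathcal F}_{\lambda^*}(\boldsymbol{x})&O\end{pmatrix},$$ where $\lambda^*=\lambda$ if $n+l$ is even and $\lambda^*=\lambda^0=(\lambda_1,\dots,\lambda_l,0)$ if $n+l$ is odd. Conventions for two-component indices which are not strict partitions: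 $P^{\mathcal F}_{(s,r)}(\boldsymbol{x})=-P^{\mathcal F}_{(r,s)}(\boldsymbol{x})$, $P^{\mathcal F}_{(r,0)}(\boldsymbol{x})=-P^{\mathcal F}_{(0,r)}(\boldsymbol{x})=P^{\mathcal F}_{(r)}(\boldsymbol{x})$, $P^{\mathcal F}_{(0,0)}(\boldsymbol{x})=0$ for positive integers $r,s$ (in particular $P^{\mathcal F}_{(r,r)}=0$). *)

theory Defs
  imports
    "HOL-Library.Poly_Mapping"
    "HOL-Computational_Algebra.Fraction_Field"
    "HOL-Computational_Algebra.Polynomial"
    "HOL-Combinatorics.Permutations"
    "Jordan_Normal_Form.Matrix"
begin

text \<open>The field of rational functions over \<open>'k\<close> in the indeterminates indexed by \<^typ>\<open>nat\<close>;
  it contains \<open>K(x\<^sub>1, \<dots>, x\<^sub>n)\<close> for every \<open>n\<close>.\<close>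

type_synonym 'k ratfun = "((nat \<Rightarrow>\<^sub>0 nat) \<Rightarrow>\<^sub>0 'k) fract"

definition ratfun_const :: "'k::field \<Rightarrow> 'k ratfun" where
  "ratfun_const c = Fraction_Field.Fract (Poly_Mapping.single 0 c) 1"

text \<open>Indices start at 0: \<open>indet i\<close> is the indeterminate \<open>x\<^sub>i\<^sub>+\<^sub>1\<close>.\<close>

definition indet :: "nat \<Rightarrow> 'k::field ratfun" where
  "indet i = Fraction_Field.Fract (Poly_Mapping.single (Poly_Mapping.single i 1) 1) 1"

definition poly_eval :: "'k::field poly \<Rightarrow> 'k ratfun \<Rightarrow> 'k ratfun" where
  "poly_eval f y = poly (map_poly ratfun_const f) y"

definition admissible :: "(nat \<Rightarrow> 'k::field poly) \<Rightarrow> bool" where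
  "admissible F \<longleftrightarrow> F 0 = 1 \<and> (\<forall>d\<ge>1. degree (F d) = d)"

definition strict_partition :: "nat list \<Rightarrow> bool" where
  "strict_partition la \<longleftrightarrow> sorted_wrt (>) la \<and> (\<forall>a\<in>set la. 0 < a)"

text \<open>The Pfaffian of a skew-symmetric matrix of even size \<open>2m\<close>, as a sum over all permutations
  normalized by \<open>2\<^sup>m m!\<close>. The division makes this meaningful in characteristic 0 only. The value on
  matrices that are not square of even size is the junk value 0.\<close>

definition pfaffian :: "'a::field mat \<Rightarrow> 'a" where
  "pfaffian M =
    (if dim_row M = dim_col M \<and> even (dim_row M) then
       (let m = dim_row M div 2 in
         (\<Sum>\<sigma> | \<sigma> permutes {0..<2 * m}.
            of_int (sign \<sigma>) * (\<Prod>i<m. M $$ (\<sigma> (2 * i), \<sigma> (2 * i + 1))))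
         / of_nat (2 ^ m * fact m))
     else 0)"

definition A_mat :: "nat \<Rightarrow> 'k::field ratfun mat" where
  "A_mat n = mat n n (\<lambda>(i, j). (indet j - indet i) / (indet j + indet i))"

definition Delta :: "nat \<Rightarrow> 'k::field ratfun" where
  "Delta n = (\<Prod>j<n. \<Prod>i<j. (indet j - indet i) / (indet j + indet i))"

definition V_mat :: "(nat \<Rightarrow> 'k::field poly) \<Rightarrow> nat \<Rightarrow> nat list \<Rightarrow> 'k ratfun mat" where
  "V_mat F n \<alpha> = mat n (length \<alpha>) (\<lambda>(i, j). poly_eval (F (\<alpha> ! j)) (indet i))"

text \<open>\<open>P_fun F n la\<close> is \<open>P\<^sup>F\<^sub>\<lambda>(x\<^sub>1, \<dots>, x\<^sub>n)\<close>; intended for strict partitions \<open>\<lambda>\<close> only.\<close>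

definition P_fun :: "(nat \<Rightarrow> 'k::field poly) \<Rightarrow> nat \<Rightarrow> nat list \<Rightarrow> 'k ratfun" where
  "P_fun F n la =
    (let la' = (if even (n + length la) then la else la @ [0]);
         V = V_mat F n la'
     in 1 / Delta n * pfaffian (four_block_mat (A_mat n) V
          (- transpose_mat V) (0\<^sub>m (length la') (length la'))))"

text \<open>\<open>P_fun\<close> on two-component indices, extended to arbitrary pairs of nonnegative integers by
  skew-symmetry, with \<open>(r, 0)\<close> standing for the one-part partition \<open>(r)\<close>.\<close>

definition P_pair :: "(nat \<Rightarrow> 'k::field poly) \<Rightarrow> nat \<Rightarrow> nat \<Rightarrow> nat \<Rightarrow> 'k ratfun" where
  "P_pair F n r s =
    (if r = s then 0
     else if s = 0 then P_fun F n [r]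
     else if r = 0 then - P_fun F n [s]
     else if s < r then P_fun F n [r, s]
     else - P_fun F n [s, r])"

definition S_mat :: "(nat \<Rightarrow> 'k::field poly) \<Rightarrow> nat \<Rightarrow> nat list \<Rightarrow> 'k ratfun mat" where
  "S_mat F n \<alpha> = mat (length \<alpha>) (length \<alpha>) (\<lambda>(i, j). P_pair F n (\<alpha> ! i) (\<alpha> ! j))"

end

theory Submission
  imports Defs
begin

text \<open>
  The theorem is an instance of the Pfaffian analogue of Sylvester's determinant identity. Let \<open>M\<close>
  be a skew-symmetric function on some index type, write \<open>pf M xs\<close> for the Pfaffian of the matrix
  that \<open>M\<close> induces on a list \<open>xs\<close> of indices, and let \<open>xs\<close> have even length with \<open>pf M xs \<noteq> 0\<close>. Then
  \<open>pf M (xs @ ys) = pf M xs * pf S ys\<close> with \<open>S b c = pf M (xs @ [b, c]) / pf M xs\<close>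
  (lemma \<open>pf_sylvester\<close>).

  For \<open>n\<close> even, take for \<open>xs\<close> the \<open>n\<close> variables and for \<open>ys\<close> the parts of the partition, padded by
  a part 0 to even length. By Schur's evaluation \<open>Pf A(x) = \<Delta>(x)\<close>, the entries of \<open>S\<close> are then the
  functions \<open>P\<close> of the pairs of parts, and the identity is the claim.

  For \<open>n\<close> odd, the list of variables is first made even by the column of \<open>f\<^sub>0 = 1\<close>. This column behaves
  like a variable at infinity, since \<open>(y - x) / (y + x)\<close> tends to 1 as \<open>y\<close> grows, so the Pfaffian of
  the enlarged list is still \<open>\<Delta>(x)\<close> (lemma \<open>pf_core\<close>). A padding part 0 can now no longer be the
  column of \<open>f\<^sub>0\<close>, which is already in use. It is represented by a formal index that pairs with the
  column of \<open>f\<^sub>0\<close> only. Its effect is to cancel that column again, which is what the definition of \<open>P\<close>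
  demands when \<open>n\<close> plus the number of parts is even (lemma \<open>P_fun_eq_pf\<close>).

  Sylvester's identity itself comes from expanding a Pfaffian along its first and along its last
  index: for lists of odd length both sides of \<open>pf_overlap\<close> are the same double sum. Taking
  two lists with a large common part makes most terms vanish and leaves the first-row expansion of
  the right-hand side of Sylvester's identity (lemma \<open>pf_tanner\<close>). The same identity, used with
  the first two indices as pivot, also proves Schur's evaluation (lemma \<open>pf_eq_pair_prod\<close>).
\<close>

section \<open>Alternating sums over the deletions of one list element\<close>
text \<open>\<open>asum G xs\<close> is \<open>\<Sum>i. (-1)\<^sup>i G x\<^sub>i xs\<^sub>i\<close>, where \<open>xs\<^sub>i\<close> is \<open>xs\<close> without its entry \<open>x\<^sub>i\<close>; see
  \<open>asum_conv_sum\<close>. The structural recursion makes the exchange laws for iterated sums below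
  provable by plain induction, without any arithmetic on positions.\<close>
fun asum :: "('i \<Rightarrow> 'i list \<Rightarrow> 'a) \<Rightarrow> 'i list \<Rightarrow> 'a::ab_group_add" where
  "asum G [] = 0"
| "asum G (x # xs) = G x xs - asum (\<lambda>y ys. G y (x # ys)) xs"

lemma asum_cong [fundef_cong]:
  assumes "xs = xs'"
    and "\<And>y ys. y \<in> set xs' \<Longrightarrow> set ys \<subseteq> set xs' \<Longrightarrow> Suc (length ys) = length xs'
      \<Longrightarrow> G y ys = G' y ys"
  shows "asum G xs = asum G' xs'"
proof -
  have "(\<And>y ys. y \<in> set xs \<Longrightarrow> set ys \<subseteq> set xs \<Longrightarrow> Suc (length ys) = length xs
      \<Longrightarrow> G y ys = G' y ys) \<Longrightarrow> asum G xs = asum G' xs"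
  proof (induction xs arbitrary: G G')
    case (Cons x xs)
    have "G x xs = G' x xs"
      by (rule Cons.prems) auto
    moreover have "asum (\<lambda>y ys. G y (x # ys)) xs = asum (\<lambda>y ys. G' y (x # ys)) xs"
      by (rule Cons.IH, rule Cons.prems) auto
    ultimately show ?case by simp
  qed simp
  then show ?thesis using assms by simp
qed

lemma asum_diff: "asum (\<lambda>y ys. G y ys - H y ys) xs = asum G xs - asum H xs"
  by (induction xs arbitrary: G H) (simp_all add: algebra_simps)

lemma asum_uminus: "asum (\<lambda>y ys. - G y ys) xs = - asum G xs"
  by (induction xs arbitrary: G) (simp_all add: algebra_simps)

lemma asum_zero: "asum (\<lambda>y ys. 0) xs = 0"
  by (induction xs) simp_all

lemma asum_mult_left:
  "asum (\<lambda>y ys. c * G y ys) xs = (c :: 'a::comm_ring) * asum G xs"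
  by (induction xs arbitrary: G) (simp_all add: algebra_simps)

lemma asum_mult_right:
  "asum (\<lambda>y ys. G y ys * c) xs = asum G xs * (c :: 'a::comm_ring)"
  using asum_mult_left [of c G xs] by (simp add: mult.commute)

text \<open>The deleted element lies in \<open>us\<close> or in \<open>vs\<close>; in the second case its position is shifted by the
  length of \<open>us\<close>, which accounts for the sign.\<close>
lemma asum_append:
  fixes G :: "'i \<Rightarrow> 'i list \<Rightarrow> 'a::comm_ring_1"
  shows "asum G (us @ vs) =
    asum (\<lambda>y ys. G y (ys @ vs)) us + (- 1) ^ length us * asum (\<lambda>y ys. G y (us @ ys)) vs"
  by (induction us arbitrary: G) (simp_all add: algebra_simps)

lemma asum_exchange:
  "asum (\<lambda>x xs'. asum (\<lambda>y ys'. H x xs' y ys') ys) xs =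
   asum (\<lambda>y ys'. asum (\<lambda>x xs'. H x xs' y ys') xs) ys"
  by (induction xs arbitrary: H) (simp_all add: asum_zero asum_diff)

text \<open>Deleting first \<open>y\<close> and then \<open>z\<close> leaves the same list as deleting first \<open>z\<close> and then \<open>y\<close>, but the
  two orders carry opposite signs, because one deletion shifts the position of the other element by
  one.\<close>
lemma asum_asum_antisym:
  "asum (\<lambda>y. asum (\<lambda>z zs. H y z zs)) xs = - asum (\<lambda>y. asum (\<lambda>z zs. H z y zs)) xs"
proof (induction xs arbitrary: H)
  case (Cons x xs)
  from Cons.IH [of "\<lambda>y z zs. H y z (x # zs)"] show ?case
    by (simp add: asum_diff algebra_simps)
qed simp

lemma asum_conv_sum:
  fixes G :: "'i \<Rightarrow> 'i list \<Rightarrow> 'a::comm_ring_1"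
  shows "asum G xs = (\<Sum>i<length xs. (- 1) ^ i * G (xs ! i) (take i xs @ drop (Suc i) xs))"
  by (induction xs arbitrary: G)
    (simp_all add: sum.lessThan_Suc_shift sum_negf del: sum.lessThan_Suc)

section \<open>Alternating functions of lists\<close>
definition alternating :: "('i list \<Rightarrow> 'a::ab_group_add) \<Rightarrow> bool" where
  "alternating g \<longleftrightarrow> (\<forall>us a b vs. g (us @ a # b # vs) = - g (us @ b # a # vs))"

lemma alternatingD: "alternating g \<Longrightarrow> g (us @ a # b # vs) = - g (us @ b # a # vs)"
  unfolding alternating_def by blast

text \<open>The element \<open>a\<close> passes the entries of \<open>vs\<close> one at a time, each at the cost of a sign.\<close>
lemma alternating_move:
  fixes g :: "'i list \<Rightarrow> 'a::comm_ring_1"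
  assumes "alternating g"
  shows "g (us @ a # vs @ ws) = (- 1) ^ length vs * g (us @ vs @ a # ws)"
proof (induction vs arbitrary: us)
  case (Cons v vs)
  from Cons.IH [of "us @ [v]"] show ?case
    using alternatingD [OF assms, of us a v "vs @ ws"] by simp
qed simp

lemma alternating_exchange:
  fixes g :: "'i list \<Rightarrow> 'a::comm_ring_1"
  assumes "alternating g"
  shows "g (us @ a # vs @ b # ws) = - g (us @ b # vs @ a # ws)"
  using alternating_move [OF assms, of us a vs "b # ws"]
    alternatingD [OF assms, of "us @ vs" a b ws] alternating_move [OF assms, of us b vs "a # ws"]
  by simp

text \<open>Exchanging two equal entries leaves the list unchanged and negates the value; dividing by 2
  requires the characteristic assumption.\<close>
lemma alternating_repeat:
  fixes g :: "'i list \<Rightarrow> 'a::field_char_0"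
  assumes "alternating g" and "\<not> distinct xs"
  shows "g xs = 0"
proof -
  from assms(2) obtain us vs ws a where "xs = us @ [a] @ vs @ [a] @ ws"
    using not_distinct_decomp by blast
  then show ?thesis using alternating_exchange [OF assms(1), of us a vs a ws] by simp
qed

text \<open>The inductive step for showing that the Pfaffian is alternating. The deletions of one of the
  two swapped entries are interchanged, and their positions differ by one; in all other terms both
  entries survive, so that the hypothesis on shorter lists applies.\<close>
lemma asum_adjacent_swap:
  assumes "\<And>y us' vs'. Suc (length us' + length vs') = length us + length vs \<Longrightarrow>
      G y (us' @ a # b # vs') = - G y (us' @ b # a # vs')"
  shows "asum G (us @ a # b # vs) = - asum G (us @ b # a # vs)"
  using assms
proof (induction us arbitrary: G)
  case Nil
  have "asum (\<lambda>y ys. G y (a # b # ys)) vs = asum (\<lambda>y ys. - G y (b # a # ys)) vs"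
    by (rule asum_cong) (use Nil.prems [of "[]"] in auto)
  then show ?case by (simp add: asum_uminus)
next
  case (Cons u us)
  have "G u (us @ a # b # vs) = - G u (us @ b # a # vs)"
    using Cons.prems by simp
  moreover have "asum (\<lambda>y ys. G y (u # ys)) (us @ a # b # vs)
      = - asum (\<lambda>y ys. G y (u # ys)) (us @ b # a # vs)"
    by (rule Cons.IH) (use Cons.prems [of "u # _"] in simp)
  ultimately show ?case by simp
qed

section \<open>Pfaffians on lists of indices\<close>
text \<open>The Pfaffian of the matrix \<open>M\<close> induces on a list of indices, defined by expansion along the first
  row. Indices may repeat and come in any order, as the identities below need.\<close>
fun pf :: "('i \<Rightarrow> 'i \<Rightarrow> 'a::comm_ring_1) \<Rightarrow> 'i list \<Rightarrow> 'a" where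
  "pf M [] = 1"
| "pf M (x # xs) = asum (\<lambda>y ys. M x y * pf M ys) xs"

lemma pf_cong:
  assumes "\<And>a b. a \<in> set xs \<Longrightarrow> b \<in> set xs \<Longrightarrow> M a b = M' a b"
  shows "pf M xs = pf M' xs"
  using assms
proof (induction xs rule: length_induct)
  case (1 xs)
  show ?case
  proof (cases xs)
    case (Cons x ys)
    have "asum (\<lambda>y ys. M x y * pf M ys) ys = asum (\<lambda>y ys. M' x y * pf M' ys) ys"
    proof (rule asum_cong)
      fix z zs assume "z \<in> set ys" "set zs \<subseteq> set ys" "Suc (length zs) = length ys"
      moreover from this have "pf M zs = pf M' zs"
        using 1 Cons by (auto simp: subset_iff)
      ultimately show "M x z * pf M zs = M' x z * pf M' zs"
        using 1(2) Cons by simp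
    qed simp
    then show ?thesis using Cons by simp
  qed simp
qed

lemma asum_map: "asum G (map f xs) = asum (\<lambda>y ys. G (f y) (map f ys)) xs"
  by (induction xs arbitrary: G) simp_all

lemma pf_map: "pf M (map f xs) = pf (\<lambda>a b. M (f a) (f b)) xs"
proof (induction xs rule: length_induct)
  case (1 xs)
  show ?case
  proof (cases xs)
    case (Cons x ys)
    then show ?thesis using 1 by (auto simp: asum_map intro!: asum_cong)
  qed simp
qed

text \<open>The factors of the deleted entry and of the remaining entries always combine to the product over
  the whole list.\<close>
lemma asum_scale:
  fixes G :: "'i \<Rightarrow> 'i list \<Rightarrow> 'a::comm_ring_1"
  shows "asum (\<lambda>y ys. g y * (prod_list (map g ys) * G y ys)) xs = prod_list (map g xs) * asum G xs"
proof (induction xs arbitrary: G)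
  case (Cons x xs)
  from Cons.IH [of "\<lambda>y ys. g x * G y (x # ys)"] show ?case
    by (simp add: asum_mult_left algebra_simps)
qed simp

lemma pf_scale: "pf (\<lambda>a b. g a * g b * M a b) xs = prod_list (map g xs) * pf M xs"
proof (induction xs rule: length_induct)
  case (1 xs)
  show ?case
  proof (cases xs)
    case (Cons x ys)
    have "asum (\<lambda>z zs. g x * g z * M x z * pf (\<lambda>a b. g a * g b * M a b) zs) ys
        = asum (\<lambda>z zs. g x * (g z * (prod_list (map g zs) * (M x z * pf M zs)))) ys"
      by (rule asum_cong) (use 1 Cons in \<open>auto simp: algebra_simps\<close>)
    then show ?thesis using Cons by (simp add: asum_mult_left asum_scale mult.assoc)
  qed simp
qed

text \<open>For a swap of the first two entries, expand along both of them. The term that pairs them with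
  each other changes sign by skew symmetry, and the remaining double sum does so by
  \<open>asum_asum_antisym\<close>. Any other swap takes place in the sublists of the first-row expansion.\<close>
lemma pf_alternating:
  assumes skew: "\<And>a b. M b a = - M a b"
  shows "alternating (pf M)"
proof -
  have "pf M (us @ a # b # vs) = - pf M (us @ b # a # vs)" for us vs a b
  proof (induction "length us + length vs" arbitrary: us vs rule: less_induct)
    case less
    show ?case
    proof (cases us)
      case Nil
      have "asum (\<lambda>y ys. M a y * pf M (b # ys)) vs
          = - asum (\<lambda>y ys. M b y * pf M (a # ys)) vs"
        using asum_asum_antisym [of "\<lambda>y z zs. M a y * (M b z * pf M zs)" vs]
        by (simp add: asum_mult_left [symmetric] mult.left_commute)
      then show ?thesis using Nil skew [of a b] by simp
    next
      case (Cons u us')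
      have "asum (\<lambda>y ys. M u y * pf M ys) (us' @ a # b # vs)
          = - asum (\<lambda>y ys. M u y * pf M ys) (us' @ b # a # vs)"
        by (rule asum_adjacent_swap) (use less Cons in simp)
      then show ?thesis using Cons by simp
    qed
  qed
  then show ?thesis unfolding alternating_def by blast
qed

text \<open>Moving \<open>b\<close> to the front past an odd number of entries costs a sign, which skew symmetry of the
  entries \<open>M b y\<close> absorbs.\<close>
lemma pf_expand_last:
  assumes skew: "\<And>a b. M b a = - M a b" and "odd (length xs)"
  shows "pf M (xs @ [b]) = asum (\<lambda>y ys. M y b * pf M ys) xs"
proof -
  have "pf M (xs @ [b]) = - pf M (b # xs)"
    using alternating_move [OF pf_alternating [of M, OF skew], of "[]" b xs "[]"] assms(2) by simp
  also have "\<dots> = asum (\<lambda>y ys. - (M b y * pf M ys)) xs"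
    by (simp add: asum_uminus)
  also have "\<dots> = asum (\<lambda>y ys. M y b * pf M ys) xs"
    by (simp add: skew [of _ b])
  finally show ?thesis .
qed

text \<open>Expanding \<open>pf M (x # ys)\<close> along \<open>x\<close> on the left and \<open>pf M (xs @ [y])\<close> along \<open>y\<close> on the right yields
  on both sides the signed sum of \<open>M x y * pf M xs' * pf M ys'\<close> over all \<open>x\<close> and \<open>y\<close>, where \<open>xs'\<close> and
  \<open>ys'\<close> are the lists without these entries.\<close>
lemma pf_overlap:
  assumes skew: "\<And>a b. M b a = - M a b" and "odd (length xs)"
  shows "asum (\<lambda>x xs'. pf M xs' * pf M (x # ys)) xs = asum (\<lambda>y ys'. pf M (xs @ [y]) * pf M ys') ys"
proof -
  have "asum (\<lambda>x xs'. pf M xs' * pf M (x # ys)) xs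
      = asum (\<lambda>x xs'. asum (\<lambda>y ys'. M x y * pf M xs' * pf M ys') ys) xs"
    by (simp add: asum_mult_left [symmetric] ac_simps)
  also have "\<dots> = asum (\<lambda>y ys'. asum (\<lambda>x xs'. M x y * pf M xs' * pf M ys') xs) ys"
    by (rule asum_exchange)
  also have "\<dots> = asum (\<lambda>y ys'. pf M (xs @ [y]) * pf M ys') ys"
    by (simp add: asum_mult_right pf_expand_last [OF skew assms(2)])
  finally show ?thesis .
qed

text \<open>The overlap identity for the lists \<open>xs @ [b]\<close> and \<open>xs @ ys\<close>. On either side the terms
  that transfer an element of \<open>xs\<close> contain a Pfaffian with that index repeated and vanish. The left side keeps
  the transfer of \<open>b\<close> alone, the right side the transfers of elements of \<open>ys\<close>.\<close>
lemma pf_tanner: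
  fixes M :: "'i \<Rightarrow> 'i \<Rightarrow> 'a::field_char_0"
  assumes skew: "\<And>a b. M b a = - M a b" and "even (length xs)"
  shows "pf M xs * pf M (xs @ b # ys) = asum (\<lambda>c zs. pf M (xs @ [b, c]) * pf M (xs @ zs)) ys"
proof -
  note alt = pf_alternating [of M, OF skew]
  have rep: "pf M (x # xs @ ys) = 0" "pf M (xs @ [b, x]) = 0" if "x \<in> set xs" for x
    using that by (auto intro!: alternating_repeat [OF alt] simp del: pf.simps)
  have "asum (\<lambda>x us. pf M us * pf M (x # xs @ ys)) (xs @ [b])
      = pf M xs * pf M (xs @ b # ys)"
  proof -
    have "asum (\<lambda>x us. pf M (us @ [b]) * pf M (x # xs @ ys)) xs = asum (\<lambda>x us. 0) xs"
      by (rule asum_cong) (simp_all add: rep del: pf.simps)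
    then show ?thesis
      using alternating_move [OF alt, of "[]" b xs ys] assms(2)
      by (simp add: asum_append asum_zero del: pf.simps)
  qed
  moreover have "asum (\<lambda>c zs. pf M ((xs @ [b]) @ [c]) * pf M zs) (xs @ ys)
      = asum (\<lambda>c zs. pf M (xs @ [b, c]) * pf M (xs @ zs)) ys"
  proof -
    have "asum (\<lambda>c zs. pf M (xs @ [b, c]) * pf M (zs @ ys)) xs = asum (\<lambda>x us. 0) xs"
      by (rule asum_cong) (simp_all add: rep del: pf.simps)
    then show ?thesis using assms(2) by (simp add: asum_append asum_zero del: pf.simps)
  qed
  ultimately show ?thesis
    using pf_overlap [of M, OF skew, of "xs @ [b]" "xs @ ys"] assms(2) by (simp del: pf.simps)
qed

text \<open>By induction the identity \<open>pf_tanner\<close> becomes the expansion of \<open>pf S ys\<close> along its first row,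
  multiplied by \<open>pf M xs\<close> twice.\<close>
lemma pf_sylvester:
  fixes M :: "'i \<Rightarrow> 'i \<Rightarrow> 'a::field_char_0"
  assumes skew: "\<And>a b. M b a = - M a b" and "even (length xs)" and nz: "pf M xs \<noteq> 0"
  shows "pf M (xs @ ys) = pf M xs * pf (\<lambda>b c. pf M (xs @ [b, c]) / pf M xs) ys"
proof (induction ys rule: length_induct)
  case (1 ys)
  define S where "S b c = pf M (xs @ [b, c]) / pf M xs" for b c
  show ?case
  proof (cases ys)
    case (Cons b zs)
    have "pf M xs * pf M (xs @ ys) = asum (\<lambda>c us. pf M (xs @ [b, c]) * pf M (xs @ us)) zs"
      unfolding Cons by (rule pf_tanner [of M, OF skew assms(2)])
    also have "\<dots> = asum (\<lambda>c us. (pf M xs * pf M xs) * (S b c * pf S us)) zs"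
    proof (rule asum_cong)
      fix c us assume "set us \<subseteq> set zs" "Suc (length us) = length zs"
      then have "pf M (xs @ us) = pf M xs * pf S us"
        using 1 Cons by (simp add: S_def [abs_def] del: pf.simps)
      then show "pf M (xs @ [b, c]) * pf M (xs @ us) = (pf M xs * pf M xs) * (S b c * pf S us)"
        using nz by (simp add: S_def del: pf.simps)
    qed simp
    also have "\<dots> = pf M xs * (pf M xs * pf S ys)"
      using Cons by (simp add: asum_mult_left)
    finally show ?thesis using nz unfolding S_def [abs_def] by simp
  qed simp
qed

section \<open>Schur's Pfaffian\<close>
fun pair_prod :: "('i \<Rightarrow> 'i \<Rightarrow> 'a::comm_monoid_mult) \<Rightarrow> 'i list \<Rightarrow> 'a" where
  "pair_prod M [] = 1"
| "pair_prod M (x # xs) = prod_list (map (M x) xs) * pair_prod M xs"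

lemma pair_prod_snoc: "pair_prod M (xs @ [y]) = pair_prod M xs * prod_list (map (\<lambda>x. M x y) xs)"
  by (induction xs) (simp_all add: ac_simps)

text \<open>Schur's product formula holds for all lists as soon as it holds for four indices. Indeed, use
  the first two indices \<open>a\<close> and \<open>b\<close> as pivot in \<open>pf_sylvester\<close>. The formula for \<open>a, b, c, d\<close> says
  that the new entry at \<open>c, d\<close> is \<open>M c d\<close>, scaled by a factor depending on \<open>c\<close> and the same
  factor for \<open>d\<close>. Such a scaling only multiplies the Pfaffian by the product of the factors, and
  the list has become shorter by two.\<close>
lemma pf_eq_pair_prod:
  fixes M :: "'i \<Rightarrow> 'i \<Rightarrow> 'a::field_char_0"
  assumes skew: "\<And>a b. M b a = - M a b" and "even (length xs)" and "distinct xs"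
    and nz: "\<And>a b. a \<in> set xs \<Longrightarrow> b \<in> set xs \<Longrightarrow> a \<noteq> b \<Longrightarrow> M a b \<noteq> 0"
    and four: "\<And>a b c d. {a, b, c, d} \<subseteq> set xs \<Longrightarrow> distinct [a, b, c, d] \<Longrightarrow>
      pf M [a, b, c, d] = pair_prod M [a, b, c, d]"
  shows "pf M xs = pair_prod M xs"
  using assms(2-)
proof (induction xs rule: induct_list012)
  case (3 a b ys)
  have self: "M c c = 0" for c using skew [of c c] by simp
  let ?g = "\<lambda>c. M a c * M b c"
  have ab: "M a b \<noteq> 0" using 3 by simp
  have "pf M ([a, b] @ ys) = pf M [a, b] * pf (\<lambda>c d. pf M ([a, b] @ [c, d]) / pf M [a, b]) ys"
    by (rule pf_sylvester [of M, OF skew]) (use ab in simp_all)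
  also have "pf (\<lambda>c d. pf M ([a, b] @ [c, d]) / pf M [a, b]) ys
      = pf (\<lambda>c d. ?g c * ?g d * M c d) ys"
  proof (rule pf_cong)
    fix c d assume cd: "c \<in> set ys" "d \<in> set ys"
    show "pf M ([a, b] @ [c, d]) / pf M [a, b] = ?g c * ?g d * M c d"
    proof (cases "c = d")
      case True
      then show ?thesis by (simp add: self)
    next
      case False
      then have "pf M [a, b, c, d] = pair_prod M [a, b, c, d]"
        using 3 cd by (intro 3) auto
      then have "pf M ([a, b] @ [c, d]) = M a b * (?g c * ?g d * M c d)"
        by (simp add: ac_simps)
      then show ?thesis using ab by simp
    qed
  qed
  also have "\<dots> = prod_list (map ?g ys) * pf M ys"
    by (rule pf_scale)
  also have "pf M ys = pair_prod M ys"
    using 3 by (intro 3) auto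
  also have "prod_list (map ?g ys) = prod_list (map (M a) ys) * prod_list (map (M b) ys)"
    by (induction ys) (simp_all add: ac_simps)
  finally show ?case by (simp add: ac_simps)
qed simp_all

section \<open>The Pfaffian as a normalized sum over permutations\<close>
text \<open>The normalization of the Pfaffian divides by a positive integer, which has to be nonzero in the
  field of rational functions.\<close>
instance fract :: ("{idom, ring_char_0}") field_char_0
proof
  have "of_nat m = (Fraction_Field.Fract (of_nat m) 1 :: 'a fract)" for m
    by (induction m) (simp_all add: Zero_fract_def One_fract_def)
  then show "inj (of_nat :: nat \<Rightarrow> 'a fract)"
    by (auto intro!: injI simp: eq_fract)
qed

text \<open>A permutation of \<open>{k..<N}\<close> is a permutation of \<open>{Suc k..<N}\<close> followed by the transposition of \<open>k\<close>
  with its image \<open>b\<close>.\<close>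
lemma sum_permutes_first:
  fixes H :: "'i list \<Rightarrow> 'a::comm_ring_1"
  assumes "k < N"
  shows "(\<Sum>\<sigma> | \<sigma> permutes {k..<N}. of_int (sign \<sigma>) * H (map (x \<circ> \<sigma>) [k..<N])) =
    (\<Sum>b\<in>{k..<N}. of_int (sign (transpose k b)) *
      (\<Sum>\<tau> | \<tau> permutes {Suc k..<N}.
        of_int (sign \<tau>) * H (x b # map (x \<circ> transpose k b \<circ> \<tau>) [Suc k..<N])))"
proof -
  have ins: "{k..<N} = insert k {Suc k..<N}" using assms by auto
  have "of_int (sign (transpose k b \<circ> \<tau>)) * H (map (x \<circ> (transpose k b \<circ> \<tau>)) [k..<N])
      = of_int (sign (transpose k b)) *
        (of_int (sign \<tau>) * H (x b # map (x \<circ> transpose k b \<circ> \<tau>) [Suc k..<N]))"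
    if "\<tau> permutes {Suc k..<N}" for b \<tau>
  proof -
    have "\<tau> k = k" using that by (auto simp: permutes_def)
    moreover have "permutation \<tau>" using that by (auto simp: permutation_permutes)
    ultimately show ?thesis
      using assms by (simp add: upt_conv_Cons sign_compose permutation_swap_id mult.assoc comp_assoc)
  qed
  then show ?thesis
    unfolding ins by (subst sum_over_permutations_insert) (simp_all add: sum_distrib_left)
qed

lemma upt_split: "i \<le> j \<Longrightarrow> j < n \<Longrightarrow> [i..<n] = [i..<j] @ j # [Suc j..<n]"
  by (metis le_add_diff_inverse less_imp_le_nat upt_add_eq_append upt_conv_Cons)

text \<open>Both effects of a transposition, on the value of \<open>g\<close> and in the prefactor, are the same sign.\<close>
lemma alternating_transpose:
  fixes g :: "'i list \<Rightarrow> 'a::comm_ring_1"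
  assumes "alternating g" and "k \<le> b" and "b < N"
  shows "of_int (sign (transpose k b)) * g (map (x \<circ> transpose k b) [k..<N]) = g (map x [k..<N])"
proof (cases "k = b")
  case False
  have upt: "[k..<N] = k # [Suc k..<b] @ b # [Suc b..<N]"
    using assms False upt_split [of "Suc k" b N] upt_conv_Cons [of k N] by simp
  have "map (x \<circ> transpose k b) [k..<N] = x b # map x [Suc k..<b] @ x k # map x [Suc b..<N]"
    unfolding upt using assms(2) by (auto simp: transpose_def simp del: upt_Suc)
  moreover have "map x [k..<N] = x k # map x [Suc k..<b] @ x b # map x [Suc b..<N]"
    unfolding upt by simp
  ultimately show ?thesis
    using alternating_exchange [OF assms(1), of "[]" "x b" "map x [Suc k..<b]" "x k"] False
    by (simp add: sign_swap_id)
qed (simp add: sign_id)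

text \<open>An element can be removed from a list by deleting it, or by exchanging it with the head and
  then dropping the head. The remaining lists differ by moving the old head back to the front, and
  for an alternating \<open>g\<close> the sign of this move turns the sign of the transposition into that of the
  deletion.\<close>
lemma asum_conv_transpose:
  fixes g :: "'i list \<Rightarrow> 'a::comm_ring_1"
  assumes "alternating g"
  shows "(\<Sum>b\<in>{k..<N}. of_int (sign (transpose k b)) *
      (f (x b) * g (map (x \<circ> transpose k b) [Suc k..<N]))) =
    asum (\<lambda>y ys. f y * g ys) (map x [k..<N])"
proof -
  have "of_int (sign (transpose k (k + i))) *
      (f (x (k + i)) * g (map (x \<circ> transpose k (k + i)) [Suc k..<N])) =
    (- 1) ^ i * (f (map x [k..<N] ! i) *
      g (take i (map x [k..<N]) @ drop (Suc i) (map x [k..<N])))" if "i < N - k" for i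
  proof (cases i)
    case 0
    then show ?thesis using that by (simp add: sign_id drop_map)
  next
    case (Suc j)
    let ?us = "map x [Suc k..<k + i]" and ?vs = "map x [Suc (k + i)..<N]"
    have upt: "[Suc k..<N] = [Suc k..<k + i] @ (k + i) # [Suc (k + i)..<N]"
      using that Suc by (intro upt_split) auto
    have "map x [k..<N] = x k # ?us @ x (k + i) # ?vs"
      using that upt by (simp add: upt_conv_Cons del: upt_Suc)
    moreover have "length ?us = j" using Suc by simp
    ultimately have "map x [k..<N] ! i = x (k + i)"
      "take i (map x [k..<N]) @ drop (Suc i) (map x [k..<N]) = x k # ?us @ ?vs"
      using Suc by (simp_all del: length_map length_upt upt_Suc add: nth_append)
    moreover have "map (x \<circ> transpose k (k + i)) [Suc k..<N] = ?us @ x k # ?vs"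
      unfolding upt by (auto simp: transpose_def simp del: upt_Suc)
    ultimately show ?thesis
      using alternating_move [OF assms, of "[]" "x k" ?us ?vs] Suc
      by (simp add: sign_swap_id mult.left_commute del: upt_Suc)
  qed
  then show ?thesis
    by (subst sum.atLeastLessThan_shift_0) (simp add: asum_conv_sum atLeast0LessThan)
qed

text \<open>The summand of a permutation in the Pfaffian, as a function of the list of its values.\<close>
fun pairing :: "('i \<Rightarrow> 'i \<Rightarrow> 'a::comm_monoid_mult) \<Rightarrow> 'i list \<Rightarrow> 'a" where
  "pairing M (a # b # xs) = M a b * pairing M xs"
| "pairing M xs = 1"

lemma pairing_snoc:
  "even (length xs) \<Longrightarrow> pairing M (xs @ [a, b]) = pairing M xs * M a b"
  by (induction xs rule: induct_list012) (simp_all add: mult.assoc)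

lemma pairing_upt: "pairing M (map y [0..<2 * m]) = (\<Prod>i<m. M (y (2 * i)) (y (2 * i + 1)))"
proof (induction m)
  case (Suc m)
  have "[0..<2 * Suc m] = [0..<2 * m] @ [2 * m, 2 * m + 1]" by simp
  then show ?case using Suc by (simp add: pairing_snoc)
qed simp

text \<open>Split off the first value of the permutation, then the second. For a fixed first value the sum
  over the second value is the expansion of the Pfaffian along the corresponding row, so it does not depend on
  the first value. The \<open>2 * m\<close> choices of the first value thus contribute equally and supply the next factor
  of \<open>2 ^ m * fact m\<close>.\<close>
lemma sum_permutes_pairing:
  fixes M :: "'i \<Rightarrow> 'i \<Rightarrow> 'a::field_char_0"
  assumes skew: "\<And>a b. M b a = - M a b"
  shows "(\<Sum>\<sigma> | \<sigma> permutes {k..<k + 2 * m}.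
      of_int (sign \<sigma>) * pairing M (map (x \<circ> \<sigma>) [k..<k + 2 * m])) =
    of_nat (2 ^ m * fact m) * pf M (map x [k..<k + 2 * m])"
proof (induction m arbitrary: k x)
  case (Suc m)
  note alt = pf_alternating [of M, OF skew]
  define N where "N = k + 2 * Suc m"
  define c :: 'a where "c = of_nat (2 ^ m * fact m)"
  let ?sg = "\<lambda>k b. of_int (sign (transpose k b)) :: 'a"
  have N: "N = Suc (Suc k) + 2 * m" "k < N" "Suc k < N" by (simp_all add: N_def)
  have IH: "(\<Sum>\<tau> | \<tau> permutes {Suc (Suc k)..<N}.
      of_int (sign \<tau>) * pairing M (map (z \<circ> \<tau>) [Suc (Suc k)..<N])) =
      c * pf M (map z [Suc (Suc k)..<N])" for z
    unfolding N(1) c_def by (rule Suc.IH)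
  \<comment> \<open>The sum with the first value fixed as \<open>y k\<close>.\<close>
  have row: "(\<Sum>\<tau> | \<tau> permutes {Suc k..<N}.
      of_int (sign \<tau>) * pairing M (y k # map (y \<circ> \<tau>) [Suc k..<N])) = c * pf M (map y [k..<N])" for y
  proof -
    have "(\<Sum>\<tau> | \<tau> permutes {Suc k..<N}.
        of_int (sign \<tau>) * pairing M (y k # map (y \<circ> \<tau>) [Suc k..<N]))
      = (\<Sum>b\<in>{Suc k..<N}. ?sg (Suc k) b *
        (\<Sum>\<tau> | \<tau> permutes {Suc (Suc k)..<N}. of_int (sign \<tau>) *
          pairing M (y k # y b # map (y \<circ> transpose (Suc k) b \<circ> \<tau>) [Suc (Suc k)..<N])))"
      by (rule sum_permutes_first [OF N(3)])
    also have "\<dots> = (\<Sum>b\<in>{Suc k..<N}. ?sg (Suc k) b * (M (y k) (y b) *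
        (\<Sum>\<tau> | \<tau> permutes {Suc (Suc k)..<N}. of_int (sign \<tau>) *
          pairing M (map (y \<circ> transpose (Suc k) b \<circ> \<tau>) [Suc (Suc k)..<N]))))"
      by (simp add: sum_distrib_left mult.left_commute)
    also have "\<dots> = c * (\<Sum>b\<in>{Suc k..<N}. ?sg (Suc k) b * (M (y k) (y b) *
        pf M (map (y \<circ> transpose (Suc k) b) [Suc (Suc k)..<N])))"
      unfolding IH by (simp add: sum_distrib_left mult.left_commute)
    also have "\<dots> = c * pf M (map y [k..<N])"
      unfolding asum_conv_transpose [OF alt] using N(2) by (simp add: upt_conv_Cons)
    finally show ?thesis .
  qed
  have "(\<Sum>\<sigma> | \<sigma> permutes {k..<N}. of_int (sign \<sigma>) * pairing M (map (x \<circ> \<sigma>) [k..<N]))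
      = (\<Sum>b\<in>{k..<N}. ?sg k b * (c * pf M (map (x \<circ> transpose k b) [k..<N])))"
    unfolding sum_permutes_first [OF N(2)] row [symmetric] by simp
  also have "\<dots> = (\<Sum>b\<in>{k..<N}. c * pf M (map x [k..<N]))"
    by (rule sum.cong) (use alternating_transpose [OF alt, of k _ N x] in
      \<open>simp_all add: mult.left_commute del: of_int_eq_iff\<close>)
  also have "\<dots> = of_nat (2 ^ Suc m * fact (Suc m)) * pf M (map x [k..<N])"
    by (simp add: N_def c_def algebra_simps)
  finally show ?case unfolding N_def .
qed simp

lemma pfaffian_mat_eq_pf:
  fixes M :: "'i \<Rightarrow> 'i \<Rightarrow> 'a::field_char_0"
  assumes skew: "\<And>a b. M b a = - M a b" and "even (length xs)"
  shows "pfaffian (mat (length xs) (length xs) (\<lambda>(i, j). M (xs ! i) (xs ! j))) = pf M xs"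
proof -
  define m where "m = length xs div 2"
  have len: "length xs = 2 * m" using assms(2) by (simp add: m_def)
  let ?A = "mat (2 * m) (2 * m) (\<lambda>(i, j). M (xs ! i) (xs ! j))"
  have "(\<Prod>i<m. ?A $$ (\<sigma> (2 * i), \<sigma> (2 * i + 1))) = pairing M (map ((!) xs \<circ> \<sigma>) [0..<0 + 2 * m])"
    if "\<sigma> permutes {0..<2 * m}" for \<sigma>
  proof -
    have "\<sigma> i < 2 * m" if "i < 2 * m" for i
      using permutes_in_image [OF \<open>\<sigma> permutes {0..<2 * m}\<close>, of i] that by simp
    then show ?thesis by (simp add: pairing_upt)
  qed
  then have "pfaffian ?A = (\<Sum>\<sigma> | \<sigma> permutes {0..<0 + 2 * m}.
      of_int (sign \<sigma>) * pairing M (map ((!) xs \<circ> \<sigma>) [0..<0 + 2 * m])) / of_nat (2 ^ m * fact m)"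
    by (simp add: pfaffian_def Let_def)
  also have "\<dots> = pf M (map ((!) xs) [0..<length xs])"
    unfolding sum_permutes_pairing [of M, OF skew] using len by simp
  finally show ?thesis by (simp add: len [symmetric] map_nth)
qed

section \<open>The generalized P-functions as Pfaffians on lists\<close>
text \<open>One index set for all matrices involved: \<open>Var i\<close> is the row of the variable \<open>x\<^sub>i\<close>, and \<open>Col r\<close> is the
  column of the polynomial \<open>f\<^sub>r\<close>. \<open>Dual\<close> pairs with \<open>Col 0\<close> only; adjoining it removes a \<open>Col 0\<close>
  already present (lemma \<open>pf_dual\<close>).\<close>
datatype node = Var nat | Col nat | Dual

fun bordered :: "(nat \<Rightarrow> 'k::field poly) \<Rightarrow> node \<Rightarrow> node \<Rightarrow> 'k ratfun" where
  "bordered F (Var i) (Var j) = (indet j - indet i) / (indet j + indet i)"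
| "bordered F (Var i) (Col r) = poly_eval (F r) (indet i)"
| "bordered F (Col r) (Var i) = - poly_eval (F r) (indet i)"
| "bordered F (Col r) Dual = (if r = 0 then - 1 else 0)"
| "bordered F Dual (Col r) = (if r = 0 then 1 else 0)"
| "bordered F _ _ = 0"

lemma bordered_skew: "bordered F q p = - bordered F p q"
  by (cases p; cases q) (simp_all add: minus_divide_left add.commute)

lemma indet_eq_iff: "(indet i :: 'k::field ratfun) = indet j \<longleftrightarrow> i = j"
proof
  assume "(indet i :: 'k ratfun) = indet j"
  then have "Poly_Mapping.single (Poly_Mapping.single i (1 :: nat)) (1 :: 'k) =
      Poly_Mapping.single (Poly_Mapping.single j 1) 1"
    by (simp add: indet_def eq_fract)
  then have "Poly_Mapping.single i (1 :: nat) = Poly_Mapping.single j 1"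
    by (metis keys_single one_neq_zero singleton_inject)
  then show "i = j"
    by (metis keys_single one_neq_zero singleton_inject)
qed simp

lemma indet_sum_nonzero: "indet j + indet i \<noteq> (0 :: 'k::field_char_0 ratfun)"
proof -
  let ?p = "Poly_Mapping.single (Poly_Mapping.single j 1) 1 +
    Poly_Mapping.single (Poly_Mapping.single i 1) 1 :: (nat \<Rightarrow>\<^sub>0 nat) \<Rightarrow>\<^sub>0 'k"
  have "Poly_Mapping.lookup ?p (Poly_Mapping.single j 1) \<noteq> 0"
    by (simp add: lookup_add lookup_single when_def)
  then have "?p \<noteq> 0" by fastforce
  then show ?thesis
    by (simp add: indet_def Zero_fract_def eq_fract)
qed

lemma poly_eval_one: "poly_eval 1 y = 1"
  by (simp add: poly_eval_def ratfun_const_def map_poly_1' One_fract_def Zero_fract_def)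

text \<open>The pivot for Sylvester's identity: the variables, made even in number by the column of
  the constant polynomial, which plays the role of a variable at infinity.\<close>
definition core :: "nat \<Rightarrow> node list" where
  "core n = map Var [0..<n] @ (if even n then [] else [Col 0])"

lemma even_length_core: "even (length (core n))"
  by (simp add: core_def)

lemma bordered_core_nonzero:
  fixes F :: "nat \<Rightarrow> 'k::field_char_0 poly"
  assumes "F 0 = 1" "p \<in> set (core n)" "q \<in> set (core n)" "p \<noteq> q"
  shows "bordered F p q \<noteq> 0"
  using assms
  by (auto simp: core_def poly_eval_one indet_sum_nonzero indet_eq_iff split: if_splits)

text \<open>If all four indices are variables this is Schur's identity for \<open>4 \<times> 4\<close> Pfaffians. The
  other cases have \<open>Col 0\<close> at one of the four positions and are the limits of that identity as the
  corresponding variable tends to infinity. In each case clearing denominators leaves a polynomial identity.\<close>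
lemma bordered_core_four_point:
  fixes F :: "nat \<Rightarrow> 'k::field_char_0 poly"
  assumes F0: "F 0 = 1" and sub: "{a, b, c, d} \<subseteq> set (core n)" and "distinct [a, b, c, d]"
  shows "pf (bordered F) [a, b, c, d] = pair_prod (bordered F) [a, b, c, d]"
proof -
  have node: "(\<exists>i. p = Var i) \<or> p = Col 0" if "p \<in> set (core n)" for p
    using that by (auto simp: core_def split: if_splits)
  have "(\<exists>i. a = Var i) \<or> a = Col 0" "(\<exists>i. b = Var i) \<or> b = Col 0"
    "(\<exists>i. c = Var i) \<or> c = Col 0" "(\<exists>i. d = Var i) \<or> d = Col 0"
    using sub by (auto intro!: node)
  then show ?thesis
    using assms(3)
    by (elim disjE exE)
      (simp_all add: F0 poly_eval_one indet_sum_nonzero divide_simps, simp_all add: algebra_simps)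
qed

text \<open>The factors contributed by \<open>Col 0\<close> to Schur's product are all 1, so the value is the same for
  both parities of \<open>n\<close>.\<close>
lemma pf_core:
  fixes F :: "nat \<Rightarrow> 'k::field_char_0 poly"
  assumes F0: "F 0 = 1"
  shows "pf (bordered F) (core n) = Delta n"
proof -
  have "pf (bordered F) (core n) = pair_prod (bordered F) (core n)"
  proof (rule pf_eq_pair_prod)
    show "distinct (core n)"
      by (simp add: core_def distinct_map inj_on_def image_iff)
  qed (rule bordered_skew even_length_core bordered_core_nonzero [of F, OF F0]
      bordered_core_four_point [of F, OF F0]; assumption)+
  also have "\<dots> = pair_prod (bordered F) (map Var [0..<n])"
    by (simp add: core_def pair_prod_snoc F0 poly_eval_one comp_def map_replicate_const)
  also have "\<dots> = Delta n"
    unfolding Delta_def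
    by (induction n) (simp_all add: pair_prod_snoc comp_def prod.list_conv_set_nth atLeast0LessThan)
  finally show ?thesis .
qed

lemma Delta_nonzero: "Delta n \<noteq> (0 :: 'k::field_char_0 ratfun)"
proof -
  have "(\<Prod>i<j. (indet j - indet i) / (indet j + indet i)) \<noteq> (0 :: 'k ratfun)" for j
    by (auto simp: indet_sum_nonzero indet_eq_iff)
  then show ?thesis by (simp add: Delta_def)
qed

definition even_pad :: "nat list \<Rightarrow> nat list" where
  "even_pad la = (if even (length la) then la else la @ [0])"

text \<open>For odd \<open>n\<close> the index \<open>Col 0\<close> is used up by \<open>core n\<close>, so a padding part 0 needs another node.\<close>
definition part_node :: "nat \<Rightarrow> nat \<Rightarrow> node" where
  "part_node n r = (if odd n \<and> r = 0 then Dual else Col r)"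

lemma pfaffian_bordered:
  fixes F :: "nat \<Rightarrow> 'k::field_char_0 poly"
  assumes "even (n + length al)"
  shows "pfaffian (four_block_mat (A_mat n) (V_mat F n al) (- transpose_mat (V_mat F n al))
      (0\<^sub>m (length al) (length al))) = pf (bordered F) (map Var [0..<n] @ map Col al)"
proof -
  let ?xs = "map Var [0..<n] @ map Col al"
  have "four_block_mat (A_mat n) (V_mat F n al) (- transpose_mat (V_mat F n al))
      (0\<^sub>m (length al) (length al)) =
    mat (length ?xs) (length ?xs) (\<lambda>(i, j). bordered F (?xs ! i) (?xs ! j))"
    by (rule eq_matI) (auto simp: A_mat_def V_mat_def nth_append)
  then show ?thesis
    using pfaffian_mat_eq_pf [of "bordered F", OF bordered_skew, of ?xs] assms by simp
qed

text \<open>In the expansion along \<open>Dual\<close> only its pairing with \<open>Col 0\<close> survives; the value of that entry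
  is \<open>- 1\<close>.\<close>
lemma pf_dual:
  assumes "even (length xs)" and orth: "\<And>y. y \<in> set xs \<Longrightarrow> bordered F y Dual = 0"
  shows "pf (bordered F) (xs @ [Col 0, Dual]) = - pf (bordered F) xs"
proof -
  have "asum (\<lambda>y ys. bordered F y Dual * pf (bordered F) (ys @ [Col 0])) xs = asum (\<lambda>y ys. 0) xs"
    by (rule asum_cong) (simp_all add: orth)
  then show ?thesis
    using pf_expand_last [of "bordered F", OF bordered_skew, of "xs @ [Col 0]" Dual] assms(1)
    by (simp add: asum_append asum_zero)
qed

text \<open>For even \<open>n\<close> this is the definition. For odd \<open>n\<close> the column of \<open>f\<^sub>0\<close> is moved from the front of
  the parts to their end. If the number of parts is even this costs no sign and puts the
  column where the definition has it. If it is odd, the sign cancels the one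
  from \<open>pf_dual\<close>, which removes the column together with \<open>Dual\<close>.\<close>
lemma P_fun_eq_pf:
  fixes F :: "nat \<Rightarrow> 'k::field_char_0 poly"
  assumes pos: "\<And>r. r \<in> set la \<Longrightarrow> 0 < r"
  shows "P_fun F n la = pf (bordered F) (core n @ map (part_node n) (even_pad la)) / Delta n"
proof -
  let ?X = "map Var [0..<n]" and ?C = "map Col la"
  note alt = pf_alternating [of "bordered F", OF bordered_skew]
  have C: "map (part_node n) la = ?C"
    using pos by (auto simp: part_node_def)
  have P: "P_fun F n la = pf (bordered F)
      (?X @ map Col (if even (n + length la) then la else la @ [0])) / Delta n"
    by (simp add: P_fun_def Let_def pfaffian_bordered del: map_append)
  consider "even n" | "odd n" "even (length la)" | "odd n" "odd (length la)" by blast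
  then show ?thesis
  proof cases
    case 1
    then have "map (part_node n) (even_pad la) = map Col (if even (n + length la) then la else la @ [0])"
      using C by (simp add: even_pad_def) (simp add: part_node_def)
    then show ?thesis using P 1 by (simp add: core_def)
  next
    case 2
    then show ?thesis
      using P alternating_move [OF alt, of ?X "Col 0" ?C "[]"]
      by (simp add: core_def even_pad_def C)
  next
    case 3
    have orth: "bordered F y Dual = 0" if "y \<in> set (?X @ ?C)" for y
      using that pos by auto
    have "pf (bordered F) (?X @ Col 0 # ?C @ [Dual]) = pf (bordered F) (?X @ ?C)"
      using alternating_move [OF alt, of ?X "Col 0" ?C "[Dual]"] 3
        pf_dual [of "?X @ ?C" F, OF _ orth] by simp
    moreover have "part_node n 0 = Dual" using 3 by (simp add: part_node_def)
    ultimately show ?thesis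
      using P 3 by (simp add: core_def even_pad_def C)
  qed
qed

text \<open>The conventions that extend \<open>P\<close> to arbitrary pairs are the ones that hold automatically for a
  Pfaffian with the two indices appended, because it is alternating.\<close>
lemma P_pair_eq_pf:
  fixes F :: "nat \<Rightarrow> 'k::field_char_0 poly"
  shows "P_pair F n r s = pf (bordered F) (core n @ [part_node n r, part_node n s]) / Delta n"
proof -
  note alt = pf_alternating [of "bordered F", OF bordered_skew]
  have swap: "pf (bordered F) (core n @ [p, q]) = - pf (bordered F) (core n @ [q, p])" for p q
    by (rule alternatingD [OF alt])
  have one: "P_fun F n [t] = pf (bordered F) (core n @ [part_node n t, part_node n 0]) / Delta n"
    if "0 < t" for t
    using P_fun_eq_pf [of "[t]" F n] that by (auto simp: even_pad_def)
  have two: "P_fun F n [t, u] = pf (bordered F) (core n @ [part_node n t, part_node n u]) / Delta n"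
    if "0 < t" "0 < u" for t u
    using P_fun_eq_pf [of "[t, u]" F n] that by (auto simp: even_pad_def)
  show ?thesis
  proof (cases "r = s")
    case True
    then have "pf (bordered F) (core n @ [part_node n r, part_node n s]) = 0"
      by (intro alternating_repeat [OF alt]) simp
    then show ?thesis using True by (simp add: P_pair_def)
  next
    case False
    then show ?thesis
      using swap [of "part_node n r" "part_node n s"]
      by (auto simp: P_pair_def one two)
  qed
qed

lemma P_pair_skew: "P_pair F n s r = - P_pair F n r s"
  by (auto simp: P_pair_def)

lemma pfaffian_S_mat:
  fixes F :: "nat \<Rightarrow> 'k::field_char_0 poly"
  assumes "even (length al)"
  shows "pfaffian (S_mat F n al) = pf (P_pair F n) al"
  unfolding S_mat_def by (rule pfaffian_mat_eq_pf [of "P_pair F n", OF P_pair_skew assms])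

theorem theorem2p6:
  fixes F :: "nat \<Rightarrow> 'k::field_char_0 poly" and n :: nat and la :: "nat list"
  assumes "admissible F" and "strict_partition la"
  shows "P_fun F n la =
    (if even (length la) then pfaffian (S_mat F n la) else pfaffian (S_mat F n (la @ [0])))"
proof -
  have F0: "F 0 = 1" using assms(1) by (simp add: admissible_def)
  have "pf (bordered F) (core n @ map (part_node n) (even_pad la))
      = Delta n * pf (\<lambda>p q. pf (bordered F) (core n @ [p, q]) / Delta n)
          (map (part_node n) (even_pad la))"
    using pf_sylvester [of "bordered F" "core n", OF bordered_skew even_length_core]
    unfolding pf_core [of F, OF F0] using Delta_nonzero by blast
  also have "\<dots> = Delta n * pf (P_pair F n) (even_pad la)"
    by (simp add: pf_map P_pair_eq_pf [abs_def])
  finally have "P_fun F n la = pf (P_pair F n) (even_pad la)"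
    using P_fun_eq_pf [of la F n] assms(2) by (simp add: strict_partition_def Delta_nonzero)
  then show ?thesis
    by (simp add: even_pad_def pfaffian_S_mat)
qed

end
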